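(* For every integer $n\geq1$, $$\nu_5(5n+4)\equiv0\pmod5,\qquad \nu_7(7n+5)\equiv0\pmod7,\qquad \nu_{11}(11n+6)\equiv0\pmod{11}.$$
   Context: For $k\geq1$, $\nu_k(n)$ denotes the number of integer partitions of $n$ having no part equal to $k$. *)

theory Defs
  imports "HOL-Library.Multiset" "HOL-Number_Theory.Cong"
begin

definition int_partitions :: "nat \<Rightarrow> nat multiset set" where
  "int_partitions n = {P. 0 \<notin># P \<and> sum_mset P = n}"

definition partitions_without :: "nat \<Rightarrow> nat \<Rightarrow> nat" ("\<nu>") where
  "\<nu> k n = card {P \<in> int_partitions n. k \<notin># P}"

(* Hence the cardinality above is a genuine count, not the default value 0. *)
lemma finite_int_partitions: "finite (int_partitions n)"
proof (rule finite_subset)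
  show "int_partitions n \<subseteq> mset ` {xs. set xs \<subseteq> {..n} \<and> length xs \<le> n}"
  proof
    fix P assume P: "P \<in> int_partitions n"
    obtain xs where xs: "P = mset xs" by (metis ex_mset)
    from P xs have s: "sum_list xs = n" and z: "0 \<notin> set xs"
      by (auto simp: int_partitions_def sum_mset_sum_list)
    have "set xs \<subseteq> {..n}" using member_le_sum_list[of _ xs] s by auto
    moreover have "length xs \<le> sum_list xs" using z by (induction xs) auto
    ultimately show "P \<in> mset ` {xs. set xs \<subseteq> {..n} \<and> length xs \<le> n}"
      using xs s by auto
  qed
  show "finite (mset ` {xs. set xs \<subseteq> {..n} \<and> length xs \<le> n})"
    by (intro finite_imageI finite_lists_length_le) simp
qed

end

theory Submission
  imports Defs "HOL-Computational_Algebra.Formal_Power_Series" "HOL-Computational_Algebra.Primes"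
begin

text \<open>
  Multiplying the generating function \<open>N\<close> of \<open>\<nu> p\<close> by the Euler product \<open>E\<close> gives
  \<open>1 - X ^ p\<close>, and \<open>E ^ p\<close> is a series in \<open>X ^ p\<close> modulo \<open>p\<close>. Hence, modulo \<open>p\<close>, the exponents
  of \<open>N\<close> lie in the residue classes occurring in \<open>E ^ (p m - 1)\<close>. The pentagonal number theorem
  and Jacobi's formula for \<open>E ^ 3\<close> restrict the classes of \<open>E\<close> and \<open>E ^ 3\<close>. For \<open>p = 5\<close> and
  \<open>p = 7\<close> the factorisations \<open>E ^ 4 = E * E ^ 3\<close> and \<open>E ^ 6 = (E ^ 3) ^ 2\<close> then miss the
  required class. For \<open>p = 11\<close> put \<open>J = E ^ 3\<close>: since \<open>J ^ 4 = E * E ^ 11\<close>, five residue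
  components of \<open>J ^ 4\<close> vanish modulo 11, and the component of \<open>J ^ 7 = E ^ 21\<close> in class 6 lies in
  the ideal that they generate.
\<close>

unbundle fps_syntax

section \<open>Truncated power series: agreement up to degree n, in place of limits\<close>

definition agree :: "nat \<Rightarrow> int fps \<Rightarrow> int fps \<Rightarrow> bool" where
  "agree n f g \<longleftrightarrow> (\<forall>k\<le>n. f $ k = g $ k)"

lemma agree_refl [simp]: "agree n f f"
  by (simp add: agree_def)

lemma agree_sym: "agree n f g \<Longrightarrow> agree n g f"
  by (simp add: agree_def)

lemma agree_trans [trans]: "agree n f g \<Longrightarrow> agree n g h \<Longrightarrow> agree n f h"
  by (simp add: agree_def)

lemma agree_mult: "agree n f f' \<Longrightarrow> agree n g g' \<Longrightarrow> agree n (f * g) (f' * g')"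
  by (auto simp: agree_def fps_mult_nth intro!: sum.cong)

lemma agree_power: "agree n f g \<Longrightarrow> agree n (f ^ k) (g ^ k)"
  by (induction k) (auto intro: agree_mult)

lemma agree_sum: "(\<And>i. i \<in> A \<Longrightarrow> agree n (f i) (g i)) \<Longrightarrow> agree n (sum f A) (sum g A)"
  by (auto simp: agree_def fps_sum_nth intro!: sum.cong)

lemma agree_X_power: "n < k \<Longrightarrow> agree n (fps_X ^ k) 0"
  by (auto simp: agree_def fps_X_power_nth)

text \<open>As \<open>h\<close> has constant term 1, coefficient k of \<open>u * h\<close> is
  \<open>u $ k\<close> plus terms in earlier coefficients of \<open>u\<close>, so the coefficients
  of \<open>f\<close> and \<open>g\<close> are forced to coincide one after another.\<close>

lemma agree_cancel:
  assumes "agree n (f * h) (g * h)" "h $ 0 = 1"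
  shows "agree n f g"
  unfolding agree_def
proof (intro allI impI)
  fix k assume "k \<le> n"
  then show "f $ k = g $ k"
  proof (induction k rule: less_induct)
    case (less k)
    have split: "(u * h) $ k = (\<Sum>i<k. u $ i * h $ (k - i)) + u $ k" for u
      using assms(2) by (simp add: fps_mult_nth atLeast0AtMost flip: lessThan_Suc_atMost)
    have "(\<Sum>i<k. f $ i * h $ (k - i)) = (\<Sum>i<k. g $ i * h $ (k - i))"
      using less by (intro sum.cong) auto
    moreover have "(f * h) $ k = (g * h) $ k"
      using assms(1) less.prems by (simp add: agree_def)
    ultimately show ?case by (simp add: split)
  qed
qed

lemma fps_eq_if_agree: "(\<And>n. agree n f g) \<Longrightarrow> f = g"
  by (auto simp: agree_def fps_eq_iff)

subsection \<open>The Euler product and the partition generating function\<close>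

definition euler_poly :: "nat \<Rightarrow> int fps" where
  "euler_poly n = (\<Prod>i=1..n. 1 - fps_X ^ i)"

lemma euler_poly_0 [simp]: "euler_poly 0 = 1"
  by (simp add: euler_poly_def)

lemma euler_poly_Suc: "euler_poly (Suc n) = euler_poly n * (1 - fps_X ^ Suc n)"
  by (simp add: euler_poly_def)

lemma euler_poly_nth_0 [simp]: "euler_poly n $ 0 = 1"
  by (induction n) (auto simp: euler_poly_Suc)

lemma agree_euler_poly: "n \<le> m \<Longrightarrow> agree n (euler_poly m) (euler_poly n)"
proof (induction m rule: dec_induct)
  case (step m)
  have "agree n (1 - fps_X ^ Suc m) 1"
    using step(1) by (auto simp: agree_def fps_X_power_nth simp del: power_Suc)
  from agree_mult[OF step(3) this] show ?case
    by (simp add: euler_poly_Suc)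
qed simp

text \<open>The infinite product of the \<open>1 - fps_X ^ i\<close>, read off along the diagonal:
  factors with i > n do not affect coefficient n.\<close>

definition euler :: "int fps" where
  "euler = Abs_fps (\<lambda>n. euler_poly n $ n)"

lemma euler_nth_0 [simp]: "euler $ 0 = 1"
  by (simp add: euler_def)

lemma agree_euler: "n \<le> m \<Longrightarrow> agree n (euler_poly m) euler"
  using agree_euler_poly unfolding agree_def euler_def
  by (metis fps_nth_Abs_fps le_trans order_refl)

definition parts_in :: "nat set \<Rightarrow> nat \<Rightarrow> nat multiset set" where
  "parts_in S n = {P. set_mset P \<subseteq> S \<and> sum_mset P = n}"

lemma finite_parts_in:
  assumes "0 \<notin> S"
  shows "finite (parts_in S n)"
  by (rule finite_subset[OF _ finite_int_partitions[of n]])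
     (use assms in \<open>auto simp: parts_in_def int_partitions_def\<close>)

text \<open>Split by whether \<open>a\<close> occurs; deleting one copy of \<open>a\<close> is a
  bijection onto the partitions of n - a, in which \<open>a\<close> may still occur.\<close>

lemma card_parts_in_insert:
  assumes "a \<notin> S" "0 \<notin> S" "0 < a"
  shows "card (parts_in (insert a S) n) =
         card (parts_in S n) + (if a \<le> n then card (parts_in (insert a S) (n - a)) else 0)"
proof -
  let ?A = "{P \<in> parts_in (insert a S) n. a \<in># P}"
  have split: "parts_in (insert a S) n = parts_in S n \<union> ?A" "parts_in S n \<inter> ?A = {}"
    using assms by (auto simp: parts_in_def)
  have A: "?A = (if a \<le> n then add_mset a ` parts_in (insert a S) (n - a) else {})"
  proof (cases "a \<le> n")
    case True
    have "P \<in> add_mset a ` parts_in (insert a S) (n - a)" if P: "P \<in> ?A" for P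
    proof -
      obtain Q where "P = add_mset a Q"
        using P by (blast dest: multi_member_split)
      with P show ?thesis by (auto simp: parts_in_def)
    qed
    with True show ?thesis by (auto simp: parts_in_def)
  next
    case False
    have "a \<le> n" if P: "P \<in> ?A" for P
    proof -
      obtain Q where "P = add_mset a Q"
        using P by (blast dest: multi_member_split)
      with P show ?thesis by (auto simp: parts_in_def)
    qed
    with False show ?thesis by auto
  qed
  have "finite (parts_in (insert a S) n)"
    using assms by (intro finite_parts_in) auto
  then have "card (parts_in (insert a S) n) = card (parts_in S n) + card ?A"
    using split by (metis card_Un_disjoint finite_Un)
  also have "card ?A = (if a \<le> n then card (parts_in (insert a S) (n - a)) else 0)"
    unfolding A by (auto simp: card_image inj_on_def)
  finally show ?thesis .
qed

text \<open>By the counting recursion, multiplication by \<open>1 - fps_X ^ a\<close> removes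
  \<open>a\<close> from the admissible parts, until only the empty partition is left.\<close>

lemma parts_in_gf:
  assumes "finite S" "0 \<notin> S"
  shows "Abs_fps (\<lambda>n. int (card (parts_in S n))) * (\<Prod>i\<in>S. 1 - fps_X ^ i) = 1"
  using assms
proof (induction S rule: finite_induct)
  case empty
  have "parts_in {} n = (if n = 0 then {{#}} else {})" for n
    by (auto simp: parts_in_def)
  then show ?case by (auto simp: fps_eq_iff)
next
  case (insert a S)
  let ?G = "\<lambda>S. Abs_fps (\<lambda>n. int (card (parts_in S n)))"
  have "?G (insert a S) * (1 - fps_X ^ a) = ?G S"
    using insert card_parts_in_insert[of a S]
    by (auto simp: fps_eq_iff right_diff_distrib fps_X_power_mult_right_nth)
  with insert show ?case by (simp add: mult.assoc [symmetric])
qed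

lemma partitions_without_eq_parts_in:
  assumes "n \<le> m"
  shows "\<nu> k n = card (parts_in ({1..m} - {k}) n)"
proof -
  have "x \<le> m" if "x \<in># P" "sum_mset P = n" for x P
    using that assms by (auto dest!: multi_member_split)
  moreover have "1 \<le> x \<longleftrightarrow> x \<noteq> 0" for x :: nat by auto
  ultimately have "P \<in> {P \<in> int_partitions n. k \<notin># P} \<longleftrightarrow> P \<in> parts_in ({1..m} - {k}) n" for P
    unfolding int_partitions_def parts_in_def mem_Collect_eq subset_iff Diff_iff
      atLeastAtMost_iff singleton_iff by metis
  then have "{P \<in> int_partitions n. k \<notin># P} = parts_in ({1..m} - {k}) n"
    by blast
  then show ?thesis by (simp add: partitions_without_def)
qed

lemma partitions_without_gf:
  assumes "0 < k"
  shows "Abs_fps (\<lambda>n. int (\<nu> k n)) * euler = 1 - fps_X ^ k"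
proof (rule fps_eq_if_agree)
  fix n
  \<comment> \<open>Large enough to keep all coefficients up to n and to have \<open>k\<close> among
    the factors of \<open>euler_poly m\<close>.\<close>
  define m where "m = n + k"
  let ?S = "{1..m} - {k}"
  let ?G = "Abs_fps (\<lambda>n. int (card (parts_in ?S n)))"
  have "euler_poly m = (1 - fps_X ^ k) * (\<Prod>i\<in>?S. 1 - fps_X ^ i)"
    unfolding euler_poly_def using assms by (intro prod.remove) (auto simp: m_def)
  then have "?G * euler_poly m = (1 - fps_X ^ k) * (?G * (\<Prod>i\<in>?S. 1 - fps_X ^ i))"
    by (simp only: mult_ac)
  also have "\<dots> = 1 - fps_X ^ k"
    by (subst parts_in_gf) auto
  finally have *: "?G * euler_poly m = 1 - fps_X ^ k" .
  have "agree n (Abs_fps (\<lambda>n. int (\<nu> k n)) * euler) (?G * euler_poly m)"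
    using partitions_without_eq_parts_in[of _ m k]
    by (intro agree_mult agree_sym[OF agree_euler]) (simp_all add: agree_def m_def)
  with * show "agree n (Abs_fps (\<lambda>n. int (\<nu> k n)) * euler) (1 - fps_X ^ k)" by simp
qed

subsection \<open>The pentagonal number theorem\<close>

fun tri :: "nat \<Rightarrow> nat" where
  "tri 0 = 0"
| "tri (Suc n) = tri n + Suc n"

lemma two_tri: "2 * tri n = n * Suc n"
  by (induction n) auto

lemma tri_eq: "tri n = n * Suc n div 2"
  by (metis nonzero_mult_div_cancel_left two_tri zero_neq_numeral)

lemma le_tri: "n \<le> tri n"
  by (cases n) auto

text \<open>For s \<le> n this is the quotient of \<open>euler_poly n\<close> by
  \<open>euler_poly s\<close>, written without division.\<close>

definition euler_tail :: "nat \<Rightarrow> nat \<Rightarrow> int fps" where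
  "euler_tail n s = (\<Prod>i=Suc s..n. 1 - fps_X ^ i)"

lemma euler_tail_0: "euler_tail n 0 = euler_poly n"
  by (simp add: euler_tail_def euler_poly_def)

lemma euler_tail_self [simp]: "euler_tail n n = 1"
  by (simp add: euler_tail_def)

lemma euler_tail_Suc: "s \<le> n \<Longrightarrow> euler_tail (Suc n) s = euler_tail n s * (1 - fps_X ^ Suc n)"
  by (simp add: euler_tail_def)

lemma euler_tail_step: "s < n \<Longrightarrow> euler_tail n s = (1 - fps_X ^ Suc s) * euler_tail n (Suc s)"
  by (simp add: euler_tail_def prod.atLeast_Suc_atMost)

text \<open>The summand measures how term s of Shanks' sum changes from n to n + 1. By
  \<open>euler_tail_step\<close> it is the difference of consecutive values of the right-hand
  side.\<close>

lemma pentagonal_telescope: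
  assumes "m \<le> n"
  shows "(\<Sum>s\<le>m. (-1) ^ s * fps_X ^ tri s * euler_tail n s *
            (fps_X ^ (s * Suc n) * (1 - fps_X ^ Suc n) - fps_X ^ (s * n)))
         = (-1) ^ Suc m * euler_tail n m * fps_X ^ (Suc m * Suc n + tri m)"
  using assms
proof (induction m)
  case 0
  then show ?case by (simp add: algebra_simps)
next
  case (Suc m)
  have step: "euler_tail n m = (1 - fps_X ^ Suc m) * euler_tail n (Suc m)"
    using Suc.prems by (intro euler_tail_step) simp
  show ?case
    unfolding sum.atMost_Suc Suc.IH[OF Suc_leD[OF Suc.prems]] step
    by (simp add: algebra_simps power_add)
qed

text \<open>Shanks' finite form of the pentagonal number theorem.\<close>

lemma euler_finite_pentagonal:
  "(\<Sum>s\<le>n. (-1) ^ s * fps_X ^ tri s * euler_tail n s * fps_X ^ (s * n))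
   = 1 + (\<Sum>s=1..n. (-1) ^ s * (fps_X ^ (s * s + tri (s - 1)) + fps_X ^ (s * s + tri s)))"
proof (induction n)
  case (Suc n)
  let ?f = "\<lambda>n s. (-1) ^ s * fps_X ^ tri s * euler_tail n s * fps_X ^ (s * n)"
  have "(\<Sum>s\<le>n. ?f (Suc n) s) - (\<Sum>s\<le>n. ?f n s) =
        (\<Sum>s\<le>n. (-1) ^ s * fps_X ^ tri s * euler_tail n s *
            (fps_X ^ (s * Suc n) * (1 - fps_X ^ Suc n) - fps_X ^ (s * n)))"
    unfolding sum_subtractf [symmetric]
    by (intro sum.cong refl) (simp add: euler_tail_Suc algebra_simps)
  also have "\<dots> = (-1) ^ Suc n * fps_X ^ (Suc n * Suc n + tri n)"
    by (subst pentagonal_telescope) auto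
  finally have "(\<Sum>s\<le>n. ?f (Suc n) s) = (\<Sum>s\<le>n. ?f n s) + (-1) ^ Suc n * fps_X ^ (Suc n * Suc n + tri n)"
    by (simp add: algebra_simps)
  \<comment> \<open>For s = n + 1, the telescoped remainder is the term with exponent s * s + tri (s
    - 1), and the new top summand on the left is the one with s * s + tri s.\<close>
  then show ?case
    using Suc by (simp add: algebra_simps power_add)
qed simp

text \<open>The exponents are the pentagonal numbers s(3s - 1)/2 and s(3s + 1)/2. In Shanks' sum,
  each term with s > 0 is divisible by a power of X beyond n, which leaves
  \<open>euler_poly n\<close>.\<close>

lemma agree_euler_pentagonal:
  "agree n euler (1 + (\<Sum>s=1..n. (-1) ^ s * (fps_X ^ (s * s + tri (s - 1)) + fps_X ^ (s * s + tri s))))"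
proof -
  let ?f = "\<lambda>s. (-1) ^ s * fps_X ^ tri s * euler_tail n s * fps_X ^ (s * n)"
  have "agree n (\<Sum>s\<le>n. ?f s) (\<Sum>s\<le>n. if s = 0 then euler_poly n else 0)"
  proof (intro agree_sum)
    fix s
    show "agree n (?f s) (if s = 0 then euler_poly n else 0)"
    proof (cases "s = 0")
      case False
      have "n < tri s + s * n"
        using False le_tri[of s] by (cases s) auto
      from agree_mult[OF agree_X_power[OF this] agree_refl[of n "(-1) ^ s * euler_tail n s"]]
      show ?thesis using False by (simp add: power_add mult_ac)
    qed (simp add: euler_tail_0)
  qed
  then have "agree n (\<Sum>s\<le>n. ?f s) (euler_poly n)"
    by simp
  with agree_euler[of n n] show ?thesis
    unfolding euler_finite_pentagonal by (auto intro: agree_sym agree_trans)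
qed

subsection \<open>Jacobi's formula for the cube\<close>

text \<open>
  \<open>jac n k\<close> is the \<open>X\<close>-binomial coefficient \<open>[2n+1, n-k]\<close> times \<open>X ^ tri k\<close>. The recursion extracts
  the coefficients of \<open>z\<close> when the finite triple product is multiplied by
  \<open>(1 - z X ^ (n+1)) (z - X ^ (n+1))\<close>; it is symmetric under \<open>k \<mapsto> - 1 - k\<close>, so truncated
  subtraction supplies the right value \<open>jac n 0\<close> at index \<open>- 1\<close>.
\<close>

fun jac :: "nat \<Rightarrow> nat \<Rightarrow> int fps" where
  "jac 0 k = (if k = 0 then 1 else 0)"
| "jac (Suc n) k = (1 + fps_X ^ (2 * Suc n)) * jac n k
                 + fps_X ^ Suc n * (jac n (k - 1) + jac n (Suc k))"

lemma jac_eq_0: "n < k \<Longrightarrow> jac n k = 0"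
  by (induction n arbitrary: k) auto

text \<open>The quotient formula for the X-binomial coefficient with denominators cleared.
  Multiplied by them, the recursion becomes a polynomial identity.\<close>

lemma jac_closed:
  "k \<le> n \<Longrightarrow> jac n k * euler_poly (n - k) * euler_poly (Suc (n + k)) = fps_X ^ tri k * euler_poly (Suc (2 * n))"
proof (induction n arbitrary: k)
  case 0
  then show ?case by simp
next
  case (Suc n)
  let ?W = "euler_poly (Suc (2 * n))"
  show ?case
  proof (cases "k = Suc n")
    case True
    have "?W $ 0 = 1" by simp
    \<comment> \<open>A nonzero series can be cancelled from the induction hypothesis at k =
      n.\<close>
    then have "?W \<noteq> 0" by (metis fps_zero_nth zero_neq_one)
    then have "jac n n = fps_X ^ tri n"
      using Suc.IH[of n] by (simp add: mult_2)
    then show ?thesis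
      using True by (simp add: jac_eq_0 power_add mult_2)
  next
    case False
    define m where "m = n - k"
    have n: "n = k + m" and k: "k \<le> n"
      using False Suc.prems by (auto simp: m_def)
    let ?P = "euler_poly (Suc m) * euler_poly (Suc (Suc (n + k)))"
    let ?T = "fps_X ^ tri k * ?W"
    have mid: "jac n k * ?P = ?T * ((1 - fps_X ^ Suc m) * (1 - fps_X ^ Suc (Suc (n + k))))"
      unfolding Suc.IH[OF k, symmetric] m_def [symmetric]
        euler_poly_Suc[of m] euler_poly_Suc[of "Suc (n + k)"] by (simp only: mult_ac)
    have down: "fps_X ^ Suc n * jac n (k - 1) * ?P =
        ?T * (fps_X ^ Suc m * (1 - fps_X ^ Suc (n + k)) * (1 - fps_X ^ Suc (Suc (n + k))))"
    proof (cases k)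
      case 0
      then show ?thesis
        using Suc.IH[of 0] n
        unfolding euler_poly_Suc[of m] euler_poly_Suc[of "Suc (n + k)"] by (simp add: mult_ac)
    next
      case (Suc j)
      have IH: "jac n j * euler_poly (Suc m) * euler_poly (n + k) = fps_X ^ tri j * ?W"
        using Suc.IH[of j] n Suc by simp
      have "fps_X ^ Suc n * jac n j * ?P =
          fps_X ^ Suc n * (jac n j * euler_poly (Suc m) * euler_poly (n + k)) *
          ((1 - fps_X ^ Suc (n + k)) * (1 - fps_X ^ Suc (Suc (n + k))))"
        unfolding euler_poly_Suc[of "Suc (n + k)"] euler_poly_Suc[of "n + k"] by (simp only: mult_ac)
      also have "\<dots> = fps_X ^ Suc n * (fps_X ^ tri j * ?W) *
          ((1 - fps_X ^ Suc (n + k)) * (1 - fps_X ^ Suc (Suc (n + k))))"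
        by (simp only: IH)
      also have "fps_X ^ Suc n * (fps_X ^ tri j * ?W) = fps_X ^ Suc m * (fps_X ^ tri k * ?W)"
        by (simp add: n Suc power_add mult_ac)
      finally show ?thesis
        unfolding Suc diff_Suc_1 by (simp only: mult_ac)
    qed
    have up: "fps_X ^ Suc n * jac n (Suc k) * ?P =
        ?T * (fps_X ^ Suc (Suc (n + k)) * (1 - fps_X ^ m) * (1 - fps_X ^ Suc m))"
    proof (cases m)
      case 0
      then show ?thesis using n by (simp add: jac_eq_0)
    next
      case (Suc l)
      have IH: "jac n (Suc k) * euler_poly l * euler_poly (Suc (Suc (n + k))) = fps_X ^ tri (Suc k) * ?W"
        using Suc.IH[of "Suc k"] n Suc by simp
      have "fps_X ^ Suc n * jac n (Suc k) * ?P =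
          fps_X ^ Suc n * (jac n (Suc k) * euler_poly l * euler_poly (Suc (Suc (n + k)))) *
          ((1 - fps_X ^ m) * (1 - fps_X ^ Suc m))"
        unfolding Suc euler_poly_Suc[of "Suc l"] euler_poly_Suc[of l] by (simp only: mult_ac)
      also have "\<dots> = ?T * (fps_X ^ Suc (Suc (n + k)) * ((1 - fps_X ^ m) * (1 - fps_X ^ Suc m)))"
        unfolding IH by (simp add: power_add mult_ac)
      finally show ?thesis by (simp only: mult_ac)
    qed
    have "jac (Suc n) k * ?P = (1 + fps_X ^ (2 * Suc n)) * (jac n k * ?P) +
        fps_X ^ Suc n * jac n (k - 1) * ?P + fps_X ^ Suc n * jac n (Suc k) * ?P"
      by (simp only: jac.simps distrib_right distrib_left add.assoc mult.assoc)
    also have "\<dots> = ?T * ((1 - fps_X ^ (2 * Suc n)) * (1 - fps_X ^ Suc (2 * Suc n)))"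
    proof -
      \<comment> \<open>With n = k + m, every power involved is a monomial in X, \<open>a\<close>
        and \<open>y\<close>, so a ring identity remains.\<close>
      define a y :: "int fps" where "a = fps_X ^ m" and "y = fps_X ^ k"
      have pows: "fps_X ^ Suc m = fps_X * a" "fps_X ^ Suc (n + k) = fps_X * a * y * y"
        "fps_X ^ Suc (Suc (n + k)) = fps_X * fps_X * a * y * y" "fps_X ^ m = a"
        "fps_X ^ (2 * Suc n) = fps_X * fps_X * a * a * y * y"
        "fps_X ^ Suc (2 * Suc n) = fps_X * fps_X * fps_X * a * a * y * y"
        by (simp_all add: a_def y_def n power_add power_mult power2_eq_square mult_ac)
      show ?thesis
        unfolding mid down up pows by (simp add: algebra_simps)
    qed
    also have "\<dots> = fps_X ^ tri k * euler_poly (Suc (2 * Suc n))"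
      by (simp add: euler_poly_Suc mult_ac)
    finally show ?thesis
      using k by (simp add: m_def Suc_diff_le mult.assoc)
  qed
qed

text \<open>This is the derivative at z = 1 of the finite triple product, up to sign; pairing k with
  - 1 - k gives the weight 2k + 1. In the induction, the signed weights satisfy c(k + 1) + c(k - 1)
  = - 2 c(k), so the recursion contributes the factor
  \<open>(1 - fps_X ^ Suc n) ^ 2\<close>.\<close>

lemma jac_sum:
  "(\<Sum>k\<le>n. (-1) ^ k * of_nat (2 * k + 1) * jac n k) = euler_poly n ^ 2"
proof (induction n)
  case (Suc n)
  let ?c = "\<lambda>k. (-1) ^ k * of_nat (2 * k + 1) :: int fps"
  have top: "(\<Sum>k\<le>Suc n. ?c k * jac n k) = euler_poly n ^ 2"
    using Suc by (simp add: jac_eq_0)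
  have up: "(\<Sum>k\<le>Suc n. ?c k * jac n (Suc k)) = (\<Sum>k\<le>n. ?c k * jac n (Suc k))"
    by (simp add: jac_eq_0)
  have "(\<Sum>k\<le>Suc n. ?c k * jac n (k - 1)) + (\<Sum>k\<le>Suc n. ?c k * jac n (Suc k))
      = jac n 0 + (\<Sum>k\<le>n. ?c (Suc k) * jac n k) + (\<Sum>k\<le>n. ?c k * jac n (Suc k))"
    unfolding up by (subst sum.atMost_Suc_shift) simp
  also have "(\<Sum>k\<le>n. ?c k * jac n (Suc k)) = (\<Sum>k=1..n. ?c (k - 1) * jac n k)"
  proof -
    have "(\<Sum>k\<le>n. ?c k * jac n (Suc k)) = (\<Sum>k=1..Suc n. ?c (k - 1) * jac n k)"
      by (rule sum.reindex_bij_witness[of _ "\<lambda>k. k - 1" Suc]) auto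
    then show ?thesis by (simp add: jac_eq_0)
  qed
  also have "(\<Sum>k\<le>n. ?c (Suc k) * jac n k) = - 3 * jac n 0 + (\<Sum>k=1..n. ?c (Suc k) * jac n k)"
    by (simp add: atMost_atLeast0 sum.atLeast_Suc_atMost)
  \<comment> \<open>The boundary term 1 from truncated subtraction and c(1) = - 3 add up to - 2 = -
    2 c(0), matching the interior terms.\<close>
  also have "jac n 0 + (- 3 * jac n 0 + (\<Sum>k=1..n. ?c (Suc k) * jac n k)) + (\<Sum>k=1..n. ?c (k - 1) * jac n k)
     = - 2 * jac n 0 + (\<Sum>k=1..n. (?c (Suc k) + ?c (k - 1)) * jac n k)"
    by (simp only: sum.distrib distrib_right) simp
  also have "(\<Sum>k=1..n. (?c (Suc k) + ?c (k - 1)) * jac n k) = (\<Sum>k=1..n. - 2 * (?c k * jac n k))"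
  proof (intro sum.cong refl)
    fix k assume "k \<in> {1..n}"
    then obtain j where "k = Suc j" by (cases k) auto
    then show "(?c (Suc k) + ?c (k - 1)) * jac n k = - 2 * (?c k * jac n k)"
      by (simp add: algebra_simps)
  qed
  also have "- 2 * jac n 0 + \<dots> = - 2 * (\<Sum>k\<le>n. ?c k * jac n k)"
    by (simp add: atMost_atLeast0 sum.atLeast_Suc_atMost sum_distrib_left algebra_simps)
  finally have shift: "(\<Sum>k\<le>Suc n. ?c k * jac n (k - 1)) + (\<Sum>k\<le>Suc n. ?c k * jac n (Suc k))
     = - 2 * euler_poly n ^ 2"
    using Suc by simp
  have "(\<Sum>k\<le>Suc n. ?c k * jac (Suc n) k) =
     (1 + fps_X ^ (2 * Suc n)) * (\<Sum>k\<le>Suc n. ?c k * jac n k) +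
     fps_X ^ Suc n * ((\<Sum>k\<le>Suc n. ?c k * jac n (k - 1)) + (\<Sum>k\<le>Suc n. ?c k * jac n (Suc k)))"
    unfolding sum_distrib_left sum.distrib [symmetric]
    by (intro sum.cong refl) (simp add: algebra_simps)
  also have "\<dots> = euler_poly (Suc n) ^ 2"
    unfolding shift top euler_poly_Suc power_mult_distrib power_even_eq
    by (simp add: power2_eq_square algebra_simps del: power_Suc)
  finally show ?case .
qed simp

text \<open>With 2n in place of n, all Euler polynomials in \<open>jac_closed\<close> have index at
  least n when k \<le> n and may be replaced by \<open>euler\<close>. For k > n both sides vanish up
  to degree n, as tri k \<ge> k.\<close>

lemma agree_euler_jac:
  assumes "k \<le> 2 * n"
  shows "agree n (euler * jac (2 * n) k) (fps_X ^ tri k)"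
proof (cases "k \<le> n")
  case True
  have "agree n (jac (2*n) k * euler * euler)
                (jac (2*n) k * euler_poly (2*n - k) * euler_poly (Suc (2*n + k)))"
    using True by (intro agree_mult agree_refl agree_sym[OF agree_euler]) auto
  also have "\<dots> = fps_X ^ tri k * euler_poly (Suc (2 * (2*n)))"
    using assms by (rule jac_closed)
  also have "agree n \<dots> (fps_X ^ tri k * euler)"
    by (intro agree_mult agree_refl agree_euler) auto
  finally have "agree n (jac (2*n) k * euler) (fps_X ^ tri k)"
    by (rule agree_cancel) simp
  then show ?thesis by (simp add: mult.commute)
next
  case False
  then have "agree n (fps_X ^ tri k) 0"
    using le_tri[of k] by (intro agree_X_power) simp
  moreover from agree_mult[OF this agree_refl[of n "euler_poly (Suc (2 * (2*n)))"]]
  have "agree n (jac (2*n) k * (euler_poly (2*n - k) * euler_poly (Suc (2*n + k))))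
                (0 * (euler_poly (2*n - k) * euler_poly (Suc (2*n + k))))"
    using jac_closed[OF assms] by (simp add: mult.assoc)
  then have "agree n (jac (2*n) k) 0"
    by (rule agree_cancel) simp
  from agree_mult[OF agree_refl[of n euler] this] have "agree n (euler * jac (2*n) k) 0" by simp
  ultimately show ?thesis by (blast intro: agree_sym agree_trans)
qed

lemma agree_euler_cube:
  "agree n (euler ^ 3) (\<Sum>k\<le>2*n. (-1) ^ k * of_nat (2 * k + 1) * fps_X ^ tri k)"
proof -
  have "agree n (euler * euler ^ 2) (euler * euler_poly (2*n) ^ 2)"
    by (intro agree_mult agree_power agree_refl agree_sym[OF agree_euler]) simp
  also have "\<dots> = (\<Sum>k\<le>2*n. (-1) ^ k * of_nat (2 * k + 1) * (euler * jac (2*n) k))"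
    by (simp add: jac_sum [symmetric] sum_distrib_left mult_ac)
  also have "agree n \<dots> (\<Sum>k\<le>2*n. (-1) ^ k * of_nat (2 * k + 1) * fps_X ^ tri k)"
    by (intro agree_sum agree_mult agree_refl agree_euler_jac) simp
  finally show ?thesis by (simp only: power3_eq_cube power2_eq_square mult.assoc)
qed

subsection \<open>Residue classes of exponents modulo a prime\<close>

text \<open>The exponents whose coefficients survive modulo p lie in the classes \<open>R\<close>;
  coefficients stay integers.\<close>

definition supported :: "nat \<Rightarrow> nat set \<Rightarrow> int fps \<Rightarrow> bool" where
  "supported p R f \<longleftrightarrow> (\<forall>n. n mod p \<notin> R \<longrightarrow> int p dvd f $ n)"

lemma supported_add: "supported p R f \<Longrightarrow> supported p R g \<Longrightarrow> supported p R (f + g)"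
  by (simp add: supported_def)

lemma supported_uminus: "supported p R f \<Longrightarrow> supported p R (- f)"
  by (simp add: supported_def)

lemma supported_diff: "supported p R f \<Longrightarrow> supported p R g \<Longrightarrow> supported p R (f - g)"
  by (simp add: supported_def)

lemma supported_sum: "(\<And>i. i \<in> A \<Longrightarrow> supported p R (f i)) \<Longrightarrow> supported p R (sum f A)"
  by (auto simp: supported_def fps_sum_nth intro!: dvd_sum)

lemma supported_sign_mult: "supported p R f \<Longrightarrow> supported p R ((-1) ^ k * f)"
  by (cases "even k") (auto intro: supported_uminus)

lemma supported_X_power: "k mod p \<in> R \<Longrightarrow> supported p R (fps_X ^ k)"
  by (auto simp: supported_def fps_X_power_nth)

lemma supported_one: "0 \<in> R \<Longrightarrow> supported p R 1"
  using supported_X_power[of 0 p R] by simp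

lemma supported_of_nat_mult:
  assumes "p dvd c \<or> supported p R f"
  shows "supported p R (of_nat c * f)"
proof -
  have "(of_nat c * f) $ n = int c * f $ n" for n
    by (simp flip: fps_of_nat)
  with assms show ?thesis by (auto simp: supported_def)
qed

lemma supported_mult:
  assumes f: "supported p R f" and g: "supported p S g"
    and RS: "\<And>r s. r \<in> R \<Longrightarrow> s \<in> S \<Longrightarrow> (r + s) mod p \<in> T"
  shows "supported p T (f * g)"
  unfolding supported_def
proof (intro allI impI)
  fix n assume n: "n mod p \<notin> T"
  have "int p dvd f $ i * g $ (n - i)" if "i \<le> n" for i
  proof (cases "i mod p \<in> R \<and> (n - i) mod p \<in> S")
    case True
    then have "(i mod p + (n - i) mod p) mod p \<in> T"
      using RS by blast
    with that n show ?thesis by (simp add: mod_add_eq)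
  next
    case False
    with f g show ?thesis by (auto simp: supported_def)
  qed
  then show "int p dvd (f * g) $ n"
    by (auto simp: fps_mult_nth intro!: dvd_sum)
qed

lemma supported_0_mult: "supported p {0} f \<Longrightarrow> supported p {0} g \<Longrightarrow> supported p {0} (f * g)"
  by (rule supported_mult) auto

lemma supported_mult_0:
  assumes "supported p R f" "supported p {0} g" "R \<subseteq> {..<p}"
  shows "supported p R (f * g)"
  using assms by (intro supported_mult[of p R f "{0}" g]) auto

text \<open>Modulo p, \<open>g\<close> is a series in X^p with constant term 1. In the convolution
  at n, a term with i < n either has a factor from \<open>g\<close> divisible by p or has i in the
  class of n, where induction applies.\<close>

lemma supported_cancel_0:
  assumes "supported p R (f * g)" "supported p {0} g" "g $ 0 = 1"
  shows "supported p R f"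
  unfolding supported_def
proof (intro allI)
  fix n
  show "n mod p \<notin> R \<longrightarrow> int p dvd f $ n"
  proof (induction n rule: less_induct)
    case (less n)
    have "int p dvd f $ i * g $ (n - i)" if "i < n" "n mod p \<notin> R" for i
    proof (cases "(n - i) mod p = 0")
      case True
      then have "i mod p = n mod p"
        using that(1) by (metis add_diff_inverse_nat add.right_neutral mod_add_right_eq not_less_iff_gr_or_eq)
      with less.IH that show ?thesis by auto
    next
      case False
      with assms(2) show ?thesis by (auto simp: supported_def)
    qed
    then have "n mod p \<notin> R \<Longrightarrow> int p dvd (\<Sum>i<n. f $ i * g $ (n - i))"
      by (auto intro: dvd_sum)
    moreover have "(f * g) $ n = (\<Sum>i<n. f $ i * g $ (n - i)) + f $ n"
      using assms(3) by (simp add: fps_mult_nth atLeast0AtMost flip: lessThan_Suc_atMost)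
    ultimately show ?case
      using assms(1) by (metis dvd_add_right_iff supported_def)
  qed
qed

lemma supported_if_agree:
  assumes "\<And>n. agree n f (g n)" "\<And>n. supported p R (g n)"
  shows "supported p R f"
  using assms unfolding supported_def agree_def by (metis order_refl)

text \<open>The inner binomial coefficients in (1 - X^i)^p are divisible by p, so each factor of the
  product becomes a polynomial in X^p modulo p.\<close>

lemma supported_euler_power_prime:
  assumes "prime p"
  shows "supported p {0} (euler ^ p)"
proof -
  have base: "supported p {0} ((1 - fps_X ^ i) ^ p)" for i
  proof -
    have "supported p {0} (of_nat (p choose k) * ((-1) ^ k * fps_X ^ (i * k)))" if "k \<le> p" for k
    proof (rule supported_of_nat_mult)
      have "p dvd (p choose k)" if "k \<noteq> 0" "k \<noteq> p"
        using that \<open>k \<le> p\<close> assms by (intro dvd_choose_prime) auto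
      moreover have "supported p {0} ((-1) ^ k * fps_X ^ (i * k))" if "k = 0 \<or> k = p"
        using that by (intro supported_sign_mult supported_X_power) auto
      ultimately show "p dvd (p choose k) \<or> supported p {0} ((-1) ^ k * fps_X ^ (i * k))"
        by metis
    qed
    moreover have "(1 - fps_X ^ i) ^ p =
        (\<Sum>k\<le>p. of_nat (p choose k) * ((-1) ^ k * fps_X ^ (i * k)) :: int fps)"
    proof -
      have "(1 - fps_X ^ i) ^ p = (- (fps_X ^ i) + 1 :: int fps) ^ p" by simp
      also have "\<dots> = (\<Sum>k\<le>p. of_nat (p choose k) * (- (fps_X ^ i)) ^ k * 1 ^ (p - k))"
        by (rule binomial_ring)
      finally show ?thesis
        by (simp add: power_minus[of "fps_X ^ i"] power_mult mult.assoc)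
    qed
    ultimately show ?thesis by (auto intro: supported_sum)
  qed
  have "supported p {0} (euler_poly n ^ p)" for n
    by (induction n)
       (auto simp: euler_poly_Suc power_mult_distrib simp del: power_Suc intro!: supported_one supported_0_mult base)
  moreover have "agree n (euler ^ p) (euler_poly n ^ p)" for n
    by (intro agree_power agree_sym[OF agree_euler]) simp
  ultimately show ?thesis by (rule supported_if_agree[rotated])
qed

lemma tri_mod:
  assumes "odd p"
  shows "tri n mod p = tri (n mod p) mod p"
proof -
  have "[n * Suc n = (n mod p) * Suc (n mod p)] (mod p)"
    unfolding Suc_eq_plus1 by (intro cong_mult cong_add) (auto simp: cong_def)
  then have "[2 * tri n = 2 * tri (n mod p)] (mod p)"
    by (simp only: two_tri)
  moreover have "coprime 2 p" using assms by simp
  ultimately show ?thesis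
    using cong_mult_lcancel_nat unfolding cong_def by blast
qed

text \<open>Pentagonal numbers modulo p depend only on the index modulo p, so checking one period
  suffices. \<open>Suc j\<close> plays the role of s in s * s + tri (s - 1).\<close>

lemma supported_euler:
  assumes "odd p"
    and R: "\<forall>j\<in>{..<p}. (j * j + tri j) mod p \<in> R \<and> (Suc j * Suc j + tri j) mod p \<in> R"
  shows "supported p R euler"
proof -
  have p: "0 < p" using assms(1) by (cases p) auto
  have R': "(j * j + tri j) mod p \<in> R" "(Suc j * Suc j + tri j) mod p \<in> R" for j
  proof -
    have "[j * j + tri j = (j mod p) * (j mod p) + tri (j mod p)] (mod p)"
         "[Suc j * Suc j + tri j = Suc (j mod p) * Suc (j mod p) + tri (j mod p)] (mod p)"
      unfolding Suc_eq_plus1 using tri_mod[OF assms(1), of j]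
      by (intro cong_add cong_mult; simp add: cong_def)+
    with R p show "(j * j + tri j) mod p \<in> R" "(Suc j * Suc j + tri j) mod p \<in> R"
      unfolding cong_def by simp_all
  qed
  have "supported p R (1 + (\<Sum>s=1..n. (-1) ^ s * (fps_X ^ (s * s + tri (s - 1)) + fps_X ^ (s * s + tri s))))" for n
  proof (intro supported_add supported_sum supported_sign_mult supported_X_power supported_one)
    show "0 \<in> R" using R'(1)[of 0] by simp
    fix s assume "s \<in> {1..n}"
    then show "(s * s + tri (s - 1)) mod p \<in> R"
      using R'(2)[of "s - 1"] by simp
  qed (rule R')
  then show ?thesis
    by (rule supported_if_agree[OF agree_euler_pentagonal])
qed

text \<open>Besides periodicity, Jacobi's coefficient 2j + 1 helps: it is divisible by p at j = (p -
  1)/2, which lets one class of triangular numbers drop out.\<close>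

lemma supported_euler_cube:
  assumes "odd p" and R: "\<forall>j\<in>{..<p}. tri j mod p \<in> R \<or> p dvd 2 * j + 1"
  shows "supported p R (euler ^ 3)"
proof -
  have p: "0 < p" using assms(1) by (cases p) auto
  have R': "tri j mod p \<in> R \<or> p dvd 2 * j + 1" for j
  proof -
    have "[2 * (j mod p) + 1 = 2 * j + 1] (mod p)"
      by (intro cong_add cong_mult) (auto simp: cong_def)
    then have "p dvd 2 * (j mod p) + 1 \<longleftrightarrow> p dvd 2 * j + 1"
      by (rule cong_dvd_iff)
    with R p tri_mod[OF assms(1), of j] show ?thesis by (metis lessThan_iff mod_less_divisor)
  qed
  have "supported p R ((-1) ^ k * (of_nat (2 * k + 1) * fps_X ^ tri k))" for k
    using R'[of k]
    by (intro supported_sign_mult supported_of_nat_mult) (auto intro: supported_X_power)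
  then have "supported p R (\<Sum>k\<le>2*n. (-1) ^ k * of_nat (2 * k + 1) * fps_X ^ tri k)" for n
    by (intro supported_sum) (simp only: mult.assoc)
  then show ?thesis
    by (rule supported_if_agree[OF agree_euler_cube])
qed

section \<open>Decomposition of a series into residue components\<close>

definition residue_part :: "nat \<Rightarrow> nat \<Rightarrow> int fps \<Rightarrow> int fps" where
  "residue_part p r f = Abs_fps (\<lambda>n. if n mod p = r then f $ n else 0)"

lemma residue_part_add: "residue_part p r (f + g) = residue_part p r f + residue_part p r g"
  by (simp add: residue_part_def fps_eq_iff)

lemma residue_part_residue_part:
  "residue_part p r (residue_part p s f) = (if r = s then residue_part p r f else 0)"
  by (auto simp: residue_part_def fps_eq_iff)

text \<open>Series are graded by exponents modulo p, and \<open>(r + p - i) mod p\<close> is the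
  class r - i without truncated subtraction.\<close>

lemma residue_part_mult:
  assumes "r < p"
  shows "residue_part p r (f * g) =
    (\<Sum>i<p. residue_part p i f * residue_part p ((r + p - i) mod p) g)"
proof (rule fps_ext)
  fix n
  \<comment> \<open>For fixed k only the class i = k mod p contributes.\<close>
  have inner: "(\<Sum>i<p. residue_part p i f $ k * residue_part p ((r + p - i) mod p) g $ (n - k)) =
      (if n mod p = r then f $ k * g $ (n - k) else 0)" if "k \<le> n" for k
  proof -
    have "(\<Sum>i<p. residue_part p i f $ k * residue_part p ((r + p - i) mod p) g $ (n - k)) =
        residue_part p (k mod p) f $ k * residue_part p ((r + p - k mod p) mod p) g $ (n - k)"
      using assms by (subst sum.remove[of _ "k mod p"]) (auto simp: residue_part_def intro!: sum.neutral)
    moreover have "(n - k) mod p = (r + p - k mod p) mod p \<longleftrightarrow> n mod p = r"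
    proof -
      have kp: "k mod p < p" using assms by simp
      have "[n - k = r + p - k mod p] (mod p) \<longleftrightarrow> [n - k + k = r + p - k mod p + k] (mod p)"
        by (simp add: cong_add_rcancel_nat)
      also have "n - k + k = n" using that by simp
      also have "[r + p - k mod p + k = r] (mod p)"
      proof -
        have "[r + p - k mod p + k = r + p - k mod p + k mod p] (mod p)"
          by (intro cong_add) (auto simp: cong_def)
        also have "r + p - k mod p + k mod p = r + p" using kp by simp
        finally show ?thesis by (simp add: cong_def)
      qed
      then have "[n = r + p - k mod p + k] (mod p) \<longleftrightarrow> [n = r] (mod p)"
        by (meson cong_sym cong_trans)
      finally show ?thesis using assms by (simp add: cong_def)
    qed
    ultimately show ?thesis by (simp add: residue_part_def)
  qed
  have "(\<Sum>i<p. residue_part p i f * residue_part p ((r + p - i) mod p) g) $ n =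
      (\<Sum>k=0..n. \<Sum>i<p. residue_part p i f $ k * residue_part p ((r + p - i) mod p) g $ (n - k))"
    by (subst sum.swap) (simp add: fps_sum_nth fps_mult_nth)
  also have "\<dots> = (\<Sum>k=0..n. if n mod p = r then f $ k * g $ (n - k) else 0)"
    using inner by (intro sum.cong) auto
  also have "\<dots> = residue_part p r (f * g) $ n"
    by (simp add: residue_part_def fps_mult_nth)
  finally show "residue_part p r (f * g) $ n =
      (\<Sum>i<p. residue_part p i f * residue_part p ((r + p - i) mod p) g) $ n" ..
qed

lemma of_nat_dvd_fps_iff: "of_nat p dvd f \<longleftrightarrow> (\<forall>n. int p dvd f $ n)"
proof
  assume "of_nat p dvd f"
  then show "\<forall>n. int p dvd f $ n"
    by (auto simp: dvd_def simp flip: fps_of_nat)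
next
  assume "\<forall>n. int p dvd f $ n"
  then have "f = of_nat p * Abs_fps (\<lambda>n. f $ n div int p)"
    by (auto simp: fps_eq_iff simp flip: fps_of_nat)
  then show "of_nat p dvd f" by (metis dvd_triv_left)
qed

text \<open>Turns support into divisibility in the ring of series, where ideal membership can be
  exploited.\<close>

lemma supported_iff_residue_part:
  "supported p R f \<longleftrightarrow> (\<forall>r. r \<notin> R \<longrightarrow> of_nat p dvd residue_part p r f)"
  by (auto simp: supported_def of_nat_dvd_fps_iff residue_part_def)

lemma supported_cong: "of_nat p dvd f - g \<Longrightarrow> supported p R f \<longleftrightarrow> supported p R g"
  unfolding supported_def of_nat_dvd_fps_iff
  by (metis dvd_add_right_iff fps_sub_nth diff_add_cancel)

lemma dvd_power_diff:
  fixes x y :: "'a::comm_ring_1"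
  assumes "d dvd x - y"
  shows "d dvd x ^ n - y ^ n"
proof (induction n)
  case (Suc n)
  have "x ^ Suc n - y ^ Suc n = x * (x ^ n - y ^ n) + (x - y) * y ^ n"
    by (simp add: algebra_simps)
  with Suc assms show ?case by (simp del: power_Suc)
qed simp

text \<open>With E = \<open>euler\<close>, N * E^(pm) = E^(pm - 1) * (1 - X^p). Modulo p, both
  E^(pm) and 1 - X^p are series in X^p, so multiplying by one and cancelling the other preserves
  residue classes.\<close>

lemma partitions_without_dvd:
  assumes "0 < p" "prime p" "R \<subseteq> {..<p}" "supported p R (euler ^ (p * m - 1))"
    "0 < m" "n mod p \<notin> R"
  shows "p dvd \<nu> p n"
proof -
  let ?N = "Abs_fps (\<lambda>n. int (\<nu> p n))"
  have "supported p {0} ((euler ^ p) ^ m)"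
    using supported_euler_power_prime[OF assms(2)]
    by (induction m) (auto intro: supported_one supported_0_mult)
  then have E: "supported p {0} (euler ^ (p * m))" by (simp add: power_mult)
  have "euler ^ (p * m) = euler * euler ^ (p * m - 1)"
    using assms(1,5) by (simp flip: power_Suc)
  then have "?N * euler ^ (p * m) = euler ^ (p * m - 1) * (?N * euler)"
    by (simp add: mult_ac)
  also have "?N * euler = 1 - fps_X ^ p"
    using assms(1) by (rule partitions_without_gf)
  finally have "supported p R (?N * euler ^ (p * m))"
    using assms(3,4) by (auto intro!: supported_mult_0 supported_diff supported_one supported_X_power)
  then have "supported p R ?N"
    by (rule supported_cancel_0[OF _ E]) (simp add: fps_power_zeroth)
  with assms(6) show ?thesis by (auto simp: supported_def)
qed

subsection \<open>The congruences\<close>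

lemma supported_11_seventh_power:
  assumes J: "supported 11 {0,1,3,6,10} J" and J4: "supported 11 {0,1,2,4,5,7} (J ^ 4)"
  shows "supported 11 ({..<11} - {6}) (J ^ 7)"
proof -
  define a b c d e where parts: "a = residue_part 11 0 J" "b = residue_part 11 1 J"
    "c = residue_part 11 3 J" "d = residue_part 11 6 J" "e = residue_part 11 10 J"
  \<comment> \<open>\<open>K\<close> equals \<open>J\<close> modulo 11 but has exactly five nonzero
    components at most, so component formulas for its powers are exact equations.\<close>
  define K where "K = a + b + c + d + e"
  have [simp]: "residue_part 11 r a = (if r = 0 then a else 0)"
    "residue_part 11 r b = (if r = 1 then b else 0)"
    "residue_part 11 r c = (if r = 3 then c else 0)"
    "residue_part 11 r d = (if r = 6 then d else 0)"
    "residue_part 11 r e = (if r = 10 then e else 0)" for r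
    by (simp_all add: parts residue_part_residue_part)
  have [simp]: "residue_part 11 r K = (if r = 0 then a else if r = 1 then b else
      if r = 3 then c else if r = 6 then d else if r = 10 then e else 0)" for r
    by (simp add: K_def residue_part_add)
  have "11 dvd J $ n - K $ n" for n
  proof (cases "n mod 11 \<in> {0,1,3,6,10}")
    case True
    then have "J $ n = K $ n"
      by (auto simp: K_def parts residue_part_def)
    then show ?thesis by simp
  next
    case False
    then have "K $ n = 0"
      by (auto simp: K_def parts residue_part_def)
    with False J show ?thesis by (auto simp: supported_def)
  qed
  then have JK: "of_nat 11 dvd J - K"
    unfolding of_nat_dvd_fps_iff by simp
  have "supported 11 {0,1,2,4,5,7} (K ^ 4)"
    using J4 supported_cong[OF dvd_power_diff[OF JK, of 4]] by blast
  then have K4: "11 dvd residue_part 11 r (K ^ 4)" if "r \<in> {3,6,8,9,10}" for r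
    using that by (auto simp: supported_iff_residue_part)
  \<comment> \<open>Computing the components of the square first keeps the expansions of the fourth
    and seventh powers manageable.\<close>
  define K2 where "K2 = K * K"
  have square: "residue_part 11 0 K2 = a^2 + 2*b*e" "residue_part 11 (Suc 0) K2 = 2*a*b + d^2"
    "residue_part 11 2 K2 = b^2 + 2*c*e" "residue_part 11 3 K2 = 2*a*c"
    "residue_part 11 4 K2 = 2*b*c" "residue_part 11 5 K2 = 2*d*e"
    "residue_part 11 6 K2 = 2*a*d + c^2" "residue_part 11 7 K2 = 2*b*d"
    "residue_part 11 8 K2 = 0" "residue_part 11 9 K2 = 2*c*d + e^2"
    "residue_part 11 10 K2 = 2*a*e"
    by (simp_all add: K2_def residue_part_mult lessThan_nat_numeral power2_eq_square algebra_simps)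
  have pow4: "K ^ 4 = K2 * K2" and pow7: "K ^ 7 = K2 * K2 * K2 * K"
    by (simp_all add: K2_def eval_nat_numeral mult_ac)
  note eval = square residue_part_mult lessThan_nat_numeral
  \<comment> \<open>The components of K^4 in the classes that the hypothesis on J^4 excludes; they
    generate the ideal.\<close>
  define m3 where "m3 =
      4*a^3*c + 4*a*b^3 + 24*a*b*c*e + 6*b^2*d^2 + 12*c*d^2*e + 4*d*e^3"
  define m6 where "m6 =
      4*a^3*d + 6*a^2*c^2 + 24*a*b*d*e + 4*b^3*c + 12*b*c^2*e + 4*d^3*e"
  define m8 where "m8 =
      12*a*b^2*d + 24*a*c*d*e + 4*a*e^3 + 6*b^2*c^2 + 4*b*d^3 + 4*c^3*e"
  define m9 where "m9 =
      12*a^2*c*d + 6*a^2*e^2 + 4*a*c^3 + 4*b^3*d + 24*b*c*d*e + 4*b*e^3"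
  define m10 where "m10 =
      4*a^3*e + 24*a*b*c*d + 12*a*b*e^2 + 4*b*c^3 + 4*c*d^3 + 6*d^2*e^2"
  have "residue_part 11 3 (K ^ 4) = m3" "residue_part 11 6 (K ^ 4) = m6"
    "residue_part 11 8 (K ^ 4) = m8" "residue_part 11 9 (K ^ 4) = m9"
    "residue_part 11 10 (K ^ 4) = m10"
    unfolding pow4 m3_def m6_def m8_def m9_def m10_def
    by (simp_all add: eval) (simp_all add: algebra_simps eval_nat_numeral)
  with K4 have m: "11 dvd m3" "11 dvd m6" "11 dvd m8" "11 dvd m9" "11 dvd m10"
    by (metis insertCI)+
  have "residue_part 11 6 (K ^ 7) =
      7*a^6*d + 21*a^5*c^2 + 210*a^4*b*d*e + 140*a^3*b^3*c + 420*a^3*b*c^2*e +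
      140*a^3*d^3*e + 630*a^2*b^2*c*d^2 + 630*a^2*b^2*d*e^2 + 630*a^2*c^2*d^2*e +
      420*a^2*c*d*e^3 + 21*a^2*e^5 + 7*a*b^6 + 210*a*b^4*c*e + 420*a*b^2*c^3*d +
      630*a*b^2*c^2*e^2 + 210*a*b*c*d^4 + 420*a*b*d^3*e^2 + 210*a*c^4*d*e +
      140*a*c^3*e^3 + 21*b^5*d^2 + 420*b^3*c*d^2*e + 140*b^3*d*e^3 + 21*b^2*c^5 +
      140*b*c^3*d^3 + 630*b*c^2*d^2*e^2 + 210*b*c*d*e^4 + 7*b*e^6 + 7*c^6*e + 7*c*d^6 +
      21*d^5*e^2"
    unfolding pow7 by (simp add: eval) (simp add: algebra_simps eval_nat_numeral)
  txt \<open>The cofactors solve a linear system over the field with 11 elements.\<close>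
  also have "\<dots> =
      (4*a^2*c - b^3 - b*c*e) * m3 +
      (4*d^2*e - a^3 - a*b*e) * m6 +
      (4*a*e^2 - a*c*d - c^3) * m8 +
      (4*b^2*d - c*d*e - e^3) * m9 +
      (4*b*c^2 - a*b*d - d^3) * m10 +
      11 * (a^6*d + a^5*c^2 + 22*a^4*b*d*e + 12*a^3*b^3*c + 30*a^3*b*c^2*e +
            12*a^3*d^3*e + 54*a^2*b^2*c*d^2 + 54*a^2*b^2*d*e^2 + 54*a^2*c^2*d^2*e +
            30*a^2*c*d*e^3 + a^2*e^5 + a*b^6 + 22*a*b^4*c*e + 30*a*b^2*c^3*d +
            54*a*b^2*c^2*e^2 + 22*a*b*c*d^4 + 30*a*b*d^3*e^2 + 22*a*c^4*d*e +
            12*a*c^3*e^3 + b^5*d^2 + 30*b^3*c*d^2*e + 12*b^3*d*e^3 + b^2*c^5 +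
            12*b*c^3*d^3 + 54*b*c^2*d^2*e^2 + 22*b*c*d*e^4 + b*e^6 + c^6*e + c*d^6 +
            d^5*e^2)"
    unfolding m3_def m6_def m8_def m9_def m10_def by algebra
  finally have "11 dvd residue_part 11 6 (K ^ 7)"
    using m by (simp only: dvd_add dvd_mult dvd_triv_left)
  moreover have "residue_part 11 r (K ^ 7) = 0" if "\<not> r < 11" for r
    using that by (auto simp: residue_part_def fps_eq_iff)
  ultimately have "supported 11 ({..<11} - {6}) (K ^ 7)"
    by (auto simp: supported_iff_residue_part)
  then show ?thesis
    using supported_cong[OF dvd_power_diff[OF JK, of 7]] by blast
qed

lemma partitions_without_5_dvd: "5 dvd \<nu> 5 (5 * n + 4)"
proof (rule partitions_without_dvd[of _ "{0,1,2,3}" 1])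
  have "supported 5 {0,1,2} euler"
    by (rule supported_euler) (simp_all add: lessThan_nat_numeral tri_eq)
  moreover have "supported 5 {0,1} (euler ^ 3)"
    by (rule supported_euler_cube) (simp_all add: lessThan_nat_numeral tri_eq)
  \<comment> \<open>Sums from {0,1,2} and {0,1} never reach class 4.\<close>
  ultimately have "supported 5 {0,1,2,3} (euler * euler ^ 3)"
    by (rule supported_mult) auto
  then show "supported 5 {0,1,2,3} (euler ^ (5 * 1 - 1))"
    by (simp flip: power_Suc)
qed auto

lemma partitions_without_7_dvd: "7 dvd \<nu> 7 (7 * n + 5)"
proof (rule partitions_without_dvd[of _ "{0,1,2,3,4,6}" 1])
  have "supported 7 {0,1,3} (euler ^ 3)"
    by (rule supported_euler_cube) (simp_all add: lessThan_nat_numeral tri_eq)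
  \<comment> \<open>Two elements of {0,1,3} never sum to 5 modulo 7.\<close>
  from this this have "supported 7 {0,1,2,3,4,6} (euler ^ 3 * euler ^ 3)"
    by (rule supported_mult) auto
  then show "supported 7 {0,1,2,3,4,6} (euler ^ (7 * 1 - 1))"
    by (simp flip: power_add)
qed auto

lemma partitions_without_11_dvd: "11 dvd \<nu> 11 (11 * n + 6)"
\<comment> \<open>The choice m = 2 gives the exponent 21 = 3 * 7, a power of the cube.\<close>
proof (rule partitions_without_dvd[of _ "{..<11} - {6}" 2])
  have cube: "supported 11 {0,1,3,6,10} (euler ^ 3)"
    by (rule supported_euler_cube) (simp_all add: lessThan_nat_numeral tri_eq)
  have "supported 11 {0,1,2,4,5,7} euler"
    by (rule supported_euler) (simp_all add: lessThan_nat_numeral tri_eq)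
  then have "supported 11 {0,1,2,4,5,7} (euler * euler ^ 11)"
    by (rule supported_mult_0) (auto intro: supported_euler_power_prime)
  also have "euler * euler ^ 11 = (euler ^ 3) ^ 4"
    by (simp flip: power_mult power_Suc)
  finally have "supported 11 ({..<11} - {6}) ((euler ^ 3) ^ 7)"
    by (rule supported_11_seventh_power[OF cube])
  then show "supported 11 ({..<11} - {6}) (euler ^ (11 * 2 - 1))"
    by (simp flip: power_mult)
qed auto

theorem mainTheorem7:
  fixes n :: nat
  assumes "n \<ge> 1"
  shows "[\<nu> 5 (5 * n + 4) = 0] (mod 5) \<and>
         [\<nu> 7 (7 * n + 5) = 0] (mod 7) \<and>
         [\<nu> 11 (11 * n + 6) = 0] (mod 11)"
  using partitions_without_5_dvd partitions_without_7_dvd partitions_without_11_dvd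
  by (simp add: cong_0_iff)

end
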